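(* Let $\mathcal{P}=\{p_1,\ldots,p_k\}$ be a finite family of oriented hyperplanes in $\mathbb{R}^n$, not necessarily distinct, where the orientation of $p_i$ is specified by a unit normal vector $\mathbf{n}_i$. Then $\mathcal{P}$ is Viviani if and only if $\mathbf{n}_1+\cdots+\mathbf{n}_k=\mathbf{0}$.
   Context: For an oriented hyperplane $p_i\subset\mathbb{R}^n$ with specified unit normal $\mathbf{n}_i$ and a point $P\in\mathbb{R}^n$, the signed distance $d(P,p_i)$ is the real number whose absolute value is the Euclidean distance from $P$ to $p_i$, with $d(P,p_i)<0$ if $\mathbf{n}_i$ points to the open half-space (of the complement of $p_i$) containing $P$, and $d(P,p_i)>0$ if $\mathbf{n}_i$ points in the opposite direction (and $d(P,p_i)=0$ if $P\in p_i$). For a finite family $\mathcal{P}=\{p_1,\ldots,p_k\}$ of oriented hyperplanes (repetitions allowed), define $v:\mathbb{R}^n\to\mathbb{R}$ by $v(P)=\sum_{i=1}^k d(P,p_i)$. The family $\mathcal{P}$ is called Viviani if $v$ is a constant function on $\mathbb{R}^n$. *)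

theory Defs
  imports "HOL-Analysis.Analysis"
begin

text \<open>An oriented hyperplane is given by its point set \<open>p\<close> together with its specified unit
  normal \<open>n\<close>; the point set alone leaves the choice between \<open>n\<close> and \<open>-n\<close> open.\<close>

definition oriented_hyperplane :: "'a::euclidean_space set \<Rightarrow> 'a \<Rightarrow> bool" where
  "oriented_hyperplane p n \<longleftrightarrow> norm n = 1 \<and> (\<exists>b. p = {x. n \<bullet> x = b})"

text \<open>The component of the complement of \<open>p\<close> into which \<open>n\<close> points. For an oriented hyperplane
  \<open>p = {x. n \<bullet> x = b}\<close> this is \<open>{x. n \<bullet> x > b}\<close>, whichever base point \<open>q\<close> is used.\<close>

definition pointed_halfspace :: "'a::euclidean_space set \<Rightarrow> 'a \<Rightarrow> 'a set" where
  "pointed_halfspace p n = {x. \<exists>q\<in>p. n \<bullet> (x - q) > 0}"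

text \<open>Sign convention: negative on the side into which the normal points.\<close>

definition signed_dist :: "'a::euclidean_space \<Rightarrow> 'a set \<Rightarrow> 'a \<Rightarrow> real" where
  "signed_dist P p n =
     (if P \<in> p then 0
      else if P \<in> pointed_halfspace p n then - infdist P p
      else infdist P p)"

definition signed_dist_sum ::
    "nat \<Rightarrow> (nat \<Rightarrow> 'a::euclidean_space set) \<Rightarrow> (nat \<Rightarrow> 'a) \<Rightarrow> 'a \<Rightarrow> real" where
  "signed_dist_sum k p n P = (\<Sum>i=1..k. signed_dist P (p i) (n i))"

definition viviani ::
    "nat \<Rightarrow> (nat \<Rightarrow> 'a::euclidean_space set) \<Rightarrow> (nat \<Rightarrow> 'a) \<Rightarrow> bool" where
  "viviani k p n \<longleftrightarrow> signed_dist_sum k p n constant_on UNIV"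

end

theory Submission
  imports Defs
begin

text \<open>The sign convention makes the signed distance to the hyperplane \<open>n \<bullet> x = b\<close> with unit normal
  \<open>n\<close> equal to \<open>b - n \<bullet> P\<close> on both sides, an affine function of \<open>P\<close> whose linear part is
  \<open>- n\<close> (lemma \<open>signed_dist_hyperplane\<close>). Hence \<open>v\<close> is affine, and its linear part is given by minus
  the sum of the normals; an affine function is constant exactly when its linear part
  vanishes.\<close>

text \<open>The foot of the perpendicular from \<open>P\<close> attains the value, and Cauchy--Schwarz shows that no
  other point of the hyperplane is nearer.\<close>

lemma infdist_hyperplane:
  fixes n P :: "'a::euclidean_space"
  assumes "norm n = 1"
  shows "infdist P {x. n \<bullet> x = b} = \<bar>n \<bullet> P - b\<bar>"
proof (rule antisym)
  define q where "q = P + (b - n \<bullet> P) *\<^sub>R n"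
  have nn: "n \<bullet> n = 1"
    using assms by (simp add: norm_eq_1)
  have q: "q \<in> {x. n \<bullet> x = b}"
    by (simp add: q_def inner_add_right nn)
  have "infdist P {x. n \<bullet> x = b} \<le> dist P q"
    by (rule infdist_le[OF q])
  also have "dist P q = \<bar>n \<bullet> P - b\<bar>"
    by (simp add: q_def dist_norm assms)
  finally show "infdist P {x. n \<bullet> x = b} \<le> \<bar>n \<bullet> P - b\<bar>" .
  have "\<bar>n \<bullet> P - b\<bar> \<le> dist P y" if "n \<bullet> y = b" for y
  proof -
    have "\<bar>n \<bullet> P - b\<bar> = \<bar>n \<bullet> (P - y)\<bar>"
      by (simp add: inner_diff_right that)
    also have "\<dots> \<le> norm n * norm (P - y)"
      by (rule Cauchy_Schwarz_ineq2)
    finally show ?thesis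
      by (simp add: assms dist_norm)
  qed
  then show "\<bar>n \<bullet> P - b\<bar> \<le> infdist P {x. n \<bullet> x = b}"
    using q by (auto simp: infdist_def intro!: cINF_greatest)
qed

lemma pointed_halfspace_hyperplane:
  fixes n :: "'a::euclidean_space"
  assumes "norm n = 1"
  shows "pointed_halfspace {x. n \<bullet> x = b} n = {x. n \<bullet> x > b}"
proof -
  \<comment> \<open>Some base point must exist; otherwise the left-hand side would be empty.\<close>
  have "b *\<^sub>R n \<in> {x. n \<bullet> x = b}"
    using assms by (simp add: norm_eq_1)
  then have "\<exists>q. n \<bullet> q = b"
    by blast
  then show ?thesis
    by (auto simp: pointed_halfspace_def inner_diff_right)
qed

lemma signed_dist_hyperplane:
  fixes n P :: "'a::euclidean_space"
  assumes "norm n = 1"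
  shows "signed_dist P {x. n \<bullet> x = b} n = b - n \<bullet> P"
  by (auto simp: signed_dist_def pointed_halfspace_hyperplane[OF assms] infdist_hyperplane[OF assms])

theorem theorem1:
  fixes k :: nat
    and p :: "nat \<Rightarrow> (real ^ 'n) set"
    and n :: "nat \<Rightarrow> real ^ 'n"
  assumes "\<And>i. i \<in> {1..k} \<Longrightarrow> oriented_hyperplane (p i) (n i)"
  shows "viviani k p n \<longleftrightarrow> (\<Sum>i=1..k. n i) = 0"
proof -
  define N where "N = (\<Sum>i=1..k. n i)"
  have "\<exists>b. \<forall>i\<in>{1..k}. norm (n i) = 1 \<and> p i = {x. n i \<bullet> x = b i}"
    using assms unfolding oriented_hyperplane_def by (intro bchoice) blast
  then obtain b where b: "\<And>i. i \<in> {1..k} \<Longrightarrow> norm (n i) = 1 \<and> p i = {x. n i \<bullet> x = b i}"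
    by blast
  have affine: "signed_dist_sum k p n P = (\<Sum>i=1..k. b i) - N \<bullet> P" for P
  proof -
    have "signed_dist_sum k p n P = (\<Sum>i=1..k. b i - n i \<bullet> P)"
      unfolding signed_dist_sum_def
      by (rule sum.cong) (simp_all add: b signed_dist_hyperplane)
    then show ?thesis
      by (simp add: N_def sum_subtractf inner_sum_left)
  qed
  have "viviani k p n \<longleftrightarrow> N = 0"
  proof
    assume "viviani k p n"
    \<comment> \<open>Moving from the origin to \<open>N\<close> changes the sum by \<open>- (N \<bullet> N)\<close>.\<close>
    then have "signed_dist_sum k p n N = signed_dist_sum k p n 0"
      by (auto simp: viviani_def constant_on_def)
    then show "N = 0"
      by (simp add: affine)
  next
    assume "N = 0"
    then show "viviani k p n"
      by (simp add: viviani_def constant_on_def affine)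
  qed
  then show ?thesis
    by (simp add: N_def)
qed

end
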